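(* Let $1\to N\overset{\iota}{\to}G\overset{\pi}{\to}K\to1$ be a short exact sequence of discrete groups, where $\iota$ is regarded as an inclusion. Let $H$ be a (not necessarily normal) subgroup of $G$, and let $p_G:G\to G/H$ and $p_K:K\to K/\pi(H)$ be the quotient maps onto left coset spaces. Then: (1) there is a unique $G$-equivariant map $\rho:G/H\to K/\pi(H)$ such that $\rho\circ p_G=p_K\circ\pi$, where $g\in G$ acts on $K/\pi(H)$ by left multiplication by $\pi(g)$; (2) for any $k\in K$, the pre-image of $p_K(k)\in K/\pi(H)$ under $\rho$ is equal to $p_G(gN)$ for any $g\in\pi^{-1}(k)$, and this pre-image is invariant under the action of $N\subset G$ on $G/H$ by left multiplication; (3) $[G:H]<\infty$ if and only if $[K:\pi(H)]<\infty$ and $[N:N\cap H]<\infty$. Furthermore, let $d_G$ be a proper right-invariant metric on $G$. Let $d_{G/H}$ and $d_K$ be the quotient metrics obtained from $d_G$, let $d_{K/\pi(H)}$ be the quotient metric obtained from $d_K$, and let $d_N$ be the restriction of $d_G$ to $N$. Then: (4) $d_{K/\pi(H)}$ is the quotient metric of $d_{G/H}$ under $\rho$; (5) for any $R>0$, any $k\in K$ and any $g\in\pi^{-1}(k)$, the pre-image under $\rho$ of $P(p_K(k);R;d_{K/\pi(H)})$ is equal to $p_G\big(P(N;R;d_G)\,g\big)$, and moreover this set contains an $R$-net $p_G(Ng)$ isometric to $N/(N\cap gHg^{-1})$ with the quotient metric coming from $d_N$.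
   Context: For a metric space $(X,d)$, a subset $Y\subseteq X$ (or a point, viewed as a singleton) and $R>0$, $P(Y;R;d)=\{x\in X: d(Y,x)\le R\}$ is the closed $R$-neighbourhood of $Y$. A metric on a group is proper if its balls are finite. For a surjection $q:X\to Y$ from a metric space $(X,d_X)$, the quotient metric on $Y$ is $d_Y(y,y')=\inf\{d_X(x,x'): q(x)=y,\ q(x')=y'\}$. The metric on $G/H$ is the quotient metric under $p_G$, that on $K$ is the quotient metric under $\pi$, that on $K/\pi(H)$ is the quotient metric under $p_K$, and that on $N/(N\cap gHg^{-1})$ is the quotient metric of $d_N$. A subset $A\subseteq X$ is an $R$-net if every point of $X$ is within distance $R$ of a point of $A$.
   Formalization: In (5), the isometry of p_G(Ng) with N/(N∩gHg^{-1}) is stated for the quotient metric on p_G(Ng) coming from d_G restricted to Ng, since with the restriction of d_{G/H} it fails (G=Z^2 with l^1 metric, N=Z×0, H=Z(10,1), g=0). *)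

theory Defs
  imports "HOL-Algebra.Elementary_Groups" "HOL-Algebra.Left_Coset" "HOL-Analysis.Analysis"
begin

(* Unlike short_exact_sequence of HOL-Algebra.Exact_Sequence, the three groups may live on
   different types. *)
definition short_exact ::
  "('a, 'l) monoid_scheme \<Rightarrow> ('b, 'm) monoid_scheme \<Rightarrow> ('c, 'n) monoid_scheme
    \<Rightarrow> ('a \<Rightarrow> 'b) \<Rightarrow> ('b \<Rightarrow> 'c) \<Rightarrow> bool"
  where "short_exact N G K \<iota> \<pi> \<longleftrightarrow>
    group N \<and> group G \<and> group K \<and> \<iota> \<in> mon N G \<and> \<pi> \<in> epi G K \<and>
    kernel G K \<pi> = \<iota> ` carrier N"

(* The coset space G/H is lcosets\<^bsub>G\<^esub> H, on which g acts by C \<mapsto> g <#\<^bsub>G\<^esub> C.  The map rho is required to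
   be extensional, so that its uniqueness concerns its values on G/H only. *)
definition equivariant_factor ::
  "('a, 'm) monoid_scheme \<Rightarrow> ('b, 'n) monoid_scheme \<Rightarrow> ('a \<Rightarrow> 'b) \<Rightarrow> 'a set
    \<Rightarrow> ('a set \<Rightarrow> 'b set) \<Rightarrow> bool"
  where "equivariant_factor G K \<pi> H \<rho> \<longleftrightarrow>
    \<rho> \<in> (lcosets\<^bsub>G\<^esub> H) \<rightarrow>\<^sub>E (lcosets\<^bsub>K\<^esub> (\<pi> ` H)) \<and>
    (\<forall>g\<in>carrier G. \<forall>C\<in>lcosets\<^bsub>G\<^esub> H. \<rho> (g <#\<^bsub>G\<^esub> C) = \<pi> g <#\<^bsub>K\<^esub> \<rho> C) \<and>
    (\<forall>g\<in>carrier G. \<rho> (g <#\<^bsub>G\<^esub> H) = \<pi> g <#\<^bsub>K\<^esub> (\<pi> ` H))"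

definition proper_metric :: "'a set \<Rightarrow> ('a \<Rightarrow> 'a \<Rightarrow> real) \<Rightarrow> bool"
  where "proper_metric X d \<longleftrightarrow>
    Metric_space X d \<and> (\<forall>x\<in>X. \<forall>r. finite (Metric_space.mcball X d x r))"

definition right_invariant :: "('a, 'm) monoid_scheme \<Rightarrow> ('a \<Rightarrow> 'a \<Rightarrow> real) \<Rightarrow> bool"
  where "right_invariant G d \<longleftrightarrow>
    (\<forall>x\<in>carrier G. \<forall>y\<in>carrier G. \<forall>g\<in>carrier G. d (x \<otimes>\<^bsub>G\<^esub> g) (y \<otimes>\<^bsub>G\<^esub> g) = d x y)"

(* Only meaningful on q ` X, where the infimum is over a nonempty set. *)
definition quotient_dist ::
  "'a set \<Rightarrow> ('a \<Rightarrow> 'a \<Rightarrow> real) \<Rightarrow> ('a \<Rightarrow> 'b) \<Rightarrow> 'b \<Rightarrow> 'b \<Rightarrow> real"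
  where "quotient_dist X d q y y' =
    Inf {d x x' | x x'. x \<in> X \<and> x' \<in> X \<and> q x = y \<and> q x' = y'}"

(* P(Y;R;d), for nonempty Y. *)
definition closed_nbhd :: "'a set \<Rightarrow> ('a \<Rightarrow> 'a \<Rightarrow> real) \<Rightarrow> 'a set \<Rightarrow> real \<Rightarrow> 'a set"
  where "closed_nbhd X d Y R = {x \<in> X. (INF y\<in>Y. d y x) \<le> R}"

definition is_net :: "'a set \<Rightarrow> ('a \<Rightarrow> 'a \<Rightarrow> real) \<Rightarrow> real \<Rightarrow> 'a set \<Rightarrow> bool"
  where "is_net X d R A \<longleftrightarrow> A \<subseteq> X \<and> (\<forall>x\<in>X. \<exists>a\<in>A. d x a \<le> R)"

definition isometric ::
  "'a set \<Rightarrow> ('a \<Rightarrow> 'a \<Rightarrow> real) \<Rightarrow> 'b set \<Rightarrow> ('b \<Rightarrow> 'b \<Rightarrow> real) \<Rightarrow> bool"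
  where "isometric X d X' d' \<longleftrightarrow>
    (\<exists>f. bij_betw f X X' \<and> (\<forall>x\<in>X. \<forall>y\<in>X. d' (f x) (f y) = d x y))"

(* Pitfall: the isometry of p_G(Ng) with N/(N \<inter> gHg^-1) holds for the quotient metric on p_G(Ng)
   under p_G : Ng \<rightarrow> p_G(Ng), where Ng has the metric d_G.  The restriction of d_{G/H} to p_G(Ng)
   can be strictly smaller, and with it the isometry fails: let G = Z^2 with the l^1 metric,
   N = Z x 0, H = Z(10,1), g = 0.  Then p_G(N) = G/H has 5 points in the d_{G/H}-ball of radius 1
   (the classes of (n,0) with n = 0, 1, -1, 10, -10), while N/(N \<inter> H) = Z has 3. *)

end

theory Submission
  imports Defs
begin

text \<open>Two elements \<open>x\<close>, \<open>y\<close> of \<open>G\<close> have the same image in \<open>K/\<pi>(H)\<close> iff \<open>yH = nxH\<close> for some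
  \<open>n \<in> N\<close>; so the fibres of \<open>\<rho>\<close> are the sets \<open>p\<^sub>G(Ng) = p\<^sub>G(gN)\<close>, each a translate of \<open>p\<^sub>G(N) = N/(N \<inter> H)\<close>.
  For a proper right-invariant metric all infima of distances are attained. As \<open>N\<close> is normal,
  right-invariance makes \<open>d(N, x)\<close> invariant under multiplication of \<open>x\<close> by \<open>N\<close> on either side,
  which identifies the preimage of a ball with \<open>p\<^sub>G(P(N;R)g)\<close>.\<close>

section \<open>Quotient distances, and maps with equal fibres\<close>

lemma quotient_dist_lower:
  assumes "\<And>x x'. \<lbrakk>x \<in> X; x' \<in> X\<rbrakk> \<Longrightarrow> (0::real) \<le> d x x'" "x \<in> X" "x' \<in> X"
  shows "quotient_dist X d q (q x) (q x') \<le> d x x'"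
  unfolding quotient_dist_def using assms by (intro cInf_lower bdd_belowI[of _ 0]) auto

lemma quotient_dist_greatest:
  assumes "y \<in> q ` X" "y' \<in> q ` X"
    and "\<And>x x'. \<lbrakk>x \<in> X; x' \<in> X; q x = y; q x' = y'\<rbrakk> \<Longrightarrow> r \<le> d x x'"
  shows "r \<le> quotient_dist X d q y y'"
  unfolding quotient_dist_def using assms by (intro cInf_greatest) blast+

lemma quotient_dist_cong:
  assumes "\<And>x. x \<in> X \<Longrightarrow> q x = q' x"
  shows "quotient_dist X d q = quotient_dist X d q'"
proof -
  have "{d x x' |x x'. x \<in> X \<and> x' \<in> X \<and> q x = y \<and> q x' = y'} =
      {d x x' |x x'. x \<in> X \<and> x' \<in> X \<and> q' x = y \<and> q' x' = y'}" for y y'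
    using assms by (metis (no_types, lifting))
  then show ?thesis
    unfolding quotient_dist_def by presburger
qed

text \<open>An infimum over pairs in \<open>X\<close> can be taken in stages: first over the fibres
  of \<open>q\<close>, then over those of \<open>r\<close>. The conditions on \<open>y\<close> and
  \<open>y'\<close> keep all the sets of distances nonempty.\<close>

lemma quotient_dist_comp:
  assumes nonneg: "\<And>x x'. \<lbrakk>x \<in> X; x' \<in> X\<rbrakk> \<Longrightarrow> 0 \<le> d x x'"
    and y: "y \<in> r ` q ` X" "y' \<in> r ` q ` X"
  shows "quotient_dist (q ` X) (quotient_dist X d q) r y y' = quotient_dist X d (\<lambda>x. r (q x)) y y'"
proof (rule antisym)
  have nonneg': "0 \<le> quotient_dist X d q z z'" if "z \<in> q ` X" "z' \<in> q ` X" for z z'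
    using that by (intro quotient_dist_greatest nonneg)
  show "quotient_dist (q ` X) (quotient_dist X d q) r y y' \<le> quotient_dist X d (\<lambda>x. r (q x)) y y'"
  proof (rule quotient_dist_greatest)
    fix x x' assume x: "x \<in> X" "x' \<in> X" "r (q x) = y" "r (q x') = y'"
    have "quotient_dist (q ` X) (quotient_dist X d q) r (r (q x)) (r (q x'))
        \<le> quotient_dist X d q (q x) (q x')"
      using x nonneg' by (intro quotient_dist_lower) auto
    also have "\<dots> \<le> d x x'"
      using x nonneg by (intro quotient_dist_lower) auto
    finally show "quotient_dist (q ` X) (quotient_dist X d q) r y y' \<le> d x x'"
      using x by simp
  qed (use y in auto)
  show "quotient_dist X d (\<lambda>x. r (q x)) y y' \<le> quotient_dist (q ` X) (quotient_dist X d q) r y y'"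
  proof (rule quotient_dist_greatest[OF y])
    fix z z' assume z: "z \<in> q ` X" "z' \<in> q ` X" "r z = y" "r z' = y'"
    show "quotient_dist X d (\<lambda>x. r (q x)) y y' \<le> quotient_dist X d q z z'"
    proof (rule quotient_dist_greatest[OF z(1,2)])
      fix x x' assume "x \<in> X" "x' \<in> X" "q x = z" "q x' = z'"
      then show "quotient_dist X d (\<lambda>x. r (q x)) y y' \<le> d x x'"
        using quotient_dist_lower[of X d x x' "\<lambda>x. r (q x)"] nonneg z by simp
    qed
  qed
qed

text \<open>If \<open>p\<close> and \<open>q\<close> have the same fibres on \<open>A\<close>,
  sending \<open>p a\<close> to \<open>q a\<close> is well defined and injective. This compares an
  orbit with a coset space of its stabiliser.\<close>

lemma ex_bij_betw_images:
  assumes "\<And>a b. \<lbrakk>a \<in> A; b \<in> A\<rbrakk> \<Longrightarrow> p a = p b \<longleftrightarrow> q a = q b"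
  obtains f where "bij_betw f (p ` A) (q ` A)" "\<And>a. a \<in> A \<Longrightarrow> f (p a) = q a"
proof
  let ?f = "\<lambda>y. q (inv_into A p y)"
  show f: "?f (p a) = q a" if "a \<in> A" for a
    using that assms[of "inv_into A p (p a)" a] by (simp add: inv_into_into f_inv_into_f)
  show "bij_betw ?f (p ` A) (q ` A)"
    by (rule bij_betw_imageI) (auto simp: inj_on_def image_image f assms)
qed

section \<open>Left cosets and conjugate subgroups\<close>

lemma lcosets_eq_image: "lcosets\<^bsub>G\<^esub> H = (\<lambda>x. x <#\<^bsub>G\<^esub> H) ` carrier G"
  by (auto simp: LCOSETS_def)

context group
begin

lemma lcos_eq_iff:
  assumes "subgroup H G" "x \<in> carrier G" "y \<in> carrier G"
  shows "x <# H = y <# H \<longleftrightarrow> inv x \<otimes> y \<in> H"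
  using assms
  by (metis is_group lcos_self l_repr_independence subgroup.lcos_module_imp subgroup.lcos_module_rev)

lemma lcos_eq_iff_ex:
  assumes "subgroup H G" "x \<in> carrier G" "y \<in> carrier G"
  shows "x <# H = y <# H \<longleftrightarrow> (\<exists>h\<in>H. y = x \<otimes> h)"
proof
  assume "x <# H = y <# H"
  then have "y \<in> x <# H"
    using assms lcos_self by blast
  then show "\<exists>h\<in>H. y = x \<otimes> h"
    by (auto simp: l_coset_def)
next
  assume "\<exists>h\<in>H. y = x \<otimes> h"
  then show "x <# H = y <# H"
    using assms l_repr_independence by (auto simp: l_coset_def)
qed

text \<open>Describes the conjugate gHg^-1 as the preimage of \<open>H\<close> under conjugation by
  \<open>inv g\<close>, so that membership becomes a computation without existential
  witnesses.\<close>

lemma conjugate_eq: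
  assumes "g \<in> carrier G" "H \<subseteq> carrier G"
  shows "(g <# H) #> inv g = {x \<in> carrier G. inv g \<otimes> x \<otimes> g \<in> H}"
proof safe
  fix x assume "x \<in> (g <# H) #> inv g"
  then obtain h where h: "h \<in> H" "x = g \<otimes> h \<otimes> inv g"
    by (auto simp: l_coset_def r_coset_def)
  then show "x \<in> carrier G" "inv g \<otimes> x \<otimes> g \<in> H"
    using assms by (auto simp: m_assoc[symmetric] subsetD) (simp add: m_assoc subsetD)
next
  fix x assume x: "x \<in> carrier G" "inv g \<otimes> x \<otimes> g \<in> H"
  moreover have "x = g \<otimes> (inv g \<otimes> x \<otimes> g) \<otimes> inv g"
    using assms x by (simp add: m_assoc) (simp add: m_assoc[symmetric])
  ultimately show "x \<in> (g <# H) #> inv g"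
    unfolding l_coset_def r_coset_def by blast
qed

lemma conjugate_subgroup:
  assumes "g \<in> carrier G" "subgroup H G"
  shows "subgroup ((g <# H) #> inv g) G"
proof -
  interpret H: subgroup H G by fact
  have eq: "(g <# H) #> inv g = {x \<in> carrier G. inv g \<otimes> x \<otimes> g \<in> H}"
    using assms H.subset by (intro conjugate_eq)
  show ?thesis
  proof (rule subgroupI)
    show "(g <# H) #> inv g \<noteq> {}"
      using assms unfolding eq by (auto intro!: exI[of _ \<one>])
  next
    fix a assume "a \<in> (g <# H) #> inv g"
    then have a: "a \<in> carrier G" "inv g \<otimes> a \<otimes> g \<in> H"
      by (auto simp: eq)
    have "inv g \<otimes> inv a \<otimes> g = inv (inv g \<otimes> a \<otimes> g)"
      using a assms by (simp add: inv_mult_group m_assoc)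
    then show "inv a \<in> (g <# H) #> inv g"
      using a by (simp add: eq)
  next
    fix a b assume "a \<in> (g <# H) #> inv g" "b \<in> (g <# H) #> inv g"
    then have ab: "a \<in> carrier G" "inv g \<otimes> a \<otimes> g \<in> H" "b \<in> carrier G" "inv g \<otimes> b \<otimes> g \<in> H"
      by (auto simp: eq)
    have "inv g \<otimes> (a \<otimes> b) \<otimes> g = (inv g \<otimes> a \<otimes> g) \<otimes> (inv g \<otimes> b \<otimes> g)"
      using ab assms by (simp add: m_assoc) (simp add: m_assoc[symmetric])
    then show "a \<otimes> b \<in> (g <# H) #> inv g"
      using ab by (simp add: eq)
  qed (auto simp: eq)
qed

text \<open>The group \<open>N \<inter> ((g <# H) #> inv g)\<close> is the stabiliser of the point
  gH under left multiplication by \<open>N\<close>: the quotient (ag)^-1(bg) = g^-1(a^-1 b)g is in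
  \<open>H\<close> iff a^-1 b is in gHg^-1, and a^-1 b is in \<open>N\<close> anyway.\<close>

lemma lcos_translate_eq_iff:
  assumes "subgroup H G" "g \<in> carrier G" "subgroup N G" "a \<in> N" "b \<in> N"
  shows "(a \<otimes> g) <# H = (b \<otimes> g) <# H \<longleftrightarrow>
    a <# (N \<inter> ((g <# H) #> inv g)) = b <# (N \<inter> ((g <# H) #> inv g))"
proof -
  interpret N: subgroup N G by fact
  interpret H: subgroup H G by fact
  let ?L = "N \<inter> ((g <# H) #> inv g)"
  have L: "subgroup ?L G"
    using assms conjugate_subgroup by (intro subgroups_Inter_pair)
  have ab: "a \<in> carrier G" "b \<in> carrier G" "inv a \<otimes> b \<in> N"
    using assms by auto
  have "(a \<otimes> g) <# H = (b \<otimes> g) <# H \<longleftrightarrow> inv g \<otimes> (inv a \<otimes> b) \<otimes> g \<in> H"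
    using assms ab by (simp add: lcos_eq_iff inv_mult_group m_assoc)
  also have "\<dots> \<longleftrightarrow> inv a \<otimes> b \<in> ?L"
    using assms ab by (simp add: conjugate_eq H.subset)
  also have "\<dots> \<longleftrightarrow> a <# ?L = b <# ?L"
    using L ab by (simp add: lcos_eq_iff)
  finally show ?thesis .
qed

section \<open>Proper right-invariant metrics: attained infima and orbit isometries\<close>

lemma Inf_dist_attained:
  assumes proper: "proper_metric (carrier G) d" and inv: "right_invariant G d"
    and A: "A \<subseteq> carrier G \<times> carrier G" "A \<noteq> {}"
  shows "Inf ((\<lambda>(x, y). d x y) ` A) \<in> (\<lambda>(x, y). d x y) ` A"
proof -
  interpret Metric_space "carrier G" d
    using proper by (simp add: proper_metric_def)
  obtain x0 y0 where xy0: "(x0, y0) \<in> A"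
    using A by auto
  let ?D = "(\<lambda>(x, y). d x y) ` A"
  \<comment> \<open>The infimum of \<open>?D\<close> is decided by the distances not exceeding one
    that occurs. These turn out to be finitely many, although \<open>A\<close> may contain
    infinitely many pairs realising them.\<close>
  let ?E = "?D \<inter> {..d x0 y0}"
  have "?E \<subseteq> d \<one> ` mcball \<one> (d x0 y0)"
  proof
    fix r assume "r \<in> ?E"
    then obtain x y where xy: "(x, y) \<in> A" "r = d x y" "r \<le> d x0 y0"
      by auto
    then have "x \<in> carrier G" "y \<in> carrier G"
      using A by auto
    \<comment> \<open>Right translation by \<open>inv x\<close> moves every pair to one starting at
      \<open>\<one>\<close>, so a single finite ball accounts for all the distances in
      \<open>?E\<close>.\<close>
    then have "d \<one> (y \<otimes> inv x) = d x y"
      using inv unfolding right_invariant_def by (metis inv_closed r_inv)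
    then show "r \<in> d \<one> ` mcball \<one> (d x0 y0)"
      using xy \<open>x \<in> carrier G\<close> \<open>y \<in> carrier G\<close> by (intro image_eqI[of _ _ "y \<otimes> inv x"]) auto
  qed
  moreover have "finite (mcball \<one> (d x0 y0))"
    using proper by (simp add: proper_metric_def)
  ultimately have fin: "finite ?E"
    using finite_surj by blast
  have ne: "?E \<noteq> {}"
    using xy0 by force
  have "Inf ?D = Min ?E"
  proof (rule cInf_eq_minimum)
    show "Min ?E \<in> ?D"
      using Min_in[OF fin ne] by blast
    fix r assume r: "r \<in> ?D"
    show "Min ?E \<le> r"
    proof (cases "r \<le> d x0 y0")
      case True
      then show ?thesis
        using r fin by (intro Min_le) auto
    next
      case False
      have "Min ?E \<le> d x0 y0"
        using Min_in[OF fin ne] by blast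
      then show ?thesis
        using False by simp
    qed
  qed
  then show ?thesis
    using Min_in[OF fin ne] by auto
qed

lemma quotient_dist_attained:
  assumes "proper_metric (carrier G) d" "right_invariant G d"
    and "x0 \<in> carrier G" "y0 \<in> carrier G"
  obtains x y where "x \<in> carrier G" "y \<in> carrier G" "q x = q x0" "q y = q y0"
    "quotient_dist (carrier G) d q (q x0) (q y0) = d x y"
proof -
  let ?A = "{(x, y). x \<in> carrier G \<and> y \<in> carrier G \<and> q x = q x0 \<and> q y = q y0}"
  have "quotient_dist (carrier G) d q (q x0) (q y0) = Inf ((\<lambda>(x, y). d x y) ` ?A)"
    unfolding quotient_dist_def by (rule arg_cong[where f = Inf]) auto
  also have "\<dots> \<in> (\<lambda>(x, y). d x y) ` ?A"
    using assms by (intro Inf_dist_attained) auto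
  finally show thesis
    using that by auto
qed

text \<open>Attainment of the infimum turns the bound on the distance to \<open>Y\<close> into an
  actual point of \<open>Y\<close> within \<open>R\<close>.\<close>

lemma closed_nbhd_eq:
  assumes "proper_metric (carrier G) d" "right_invariant G d" "Y \<subseteq> carrier G" "Y \<noteq> {}"
  shows "closed_nbhd (carrier G) d Y R = {x \<in> carrier G. \<exists>y\<in>Y. d y x \<le> R}"
proof -
  interpret Metric_space "carrier G" d
    using assms by (simp add: proper_metric_def)
  have "(INF y\<in>Y. d y x) \<le> R \<longleftrightarrow> (\<exists>y\<in>Y. d y x \<le> R)" if "x \<in> carrier G" for x
  proof
    assume "(INF y\<in>Y. d y x) \<le> R"
    moreover have "Inf ((\<lambda>(y, x). d y x) ` (Y \<times> {x})) \<in> (\<lambda>(y, x). d y x) ` (Y \<times> {x})"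
      using assms that by (intro Inf_dist_attained) auto
    moreover have "(\<lambda>(y, x). d y x) ` (Y \<times> {x}) = (\<lambda>y. d y x) ` Y"
      by auto
    ultimately show "\<exists>y\<in>Y. d y x \<le> R"
      by auto
  next
    assume "\<exists>y\<in>Y. d y x \<le> R"
    then show "(INF y\<in>Y. d y x) \<le> R"
      by (auto intro!: cINF_lower2 bdd_belowI[of _ 0])
  qed
  then show ?thesis
    by (auto simp: closed_nbhd_def)
qed

text \<open>Right translation by \<open>g\<close> is an isometry from \<open>N\<close> onto Ng, and
  it carries the fibres of the coset map on \<open>N\<close> to the fibres of the coset map on Ng.
  Both quotient distances are therefore infima of the same set of numbers.\<close>

lemma isometric_orbit_coset_space:
  assumes inv: "right_invariant G d" and N: "subgroup N G" and H: "subgroup H G"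
    and g: "g \<in> carrier G"
  shows "isometric
    ((\<lambda>x. x <# H) ` (N #> g)) (quotient_dist (N #> g) d (\<lambda>x. x <# H))
    ((\<lambda>n. n <# (N \<inter> ((g <# H) #> inv g))) ` N)
    (quotient_dist N d (\<lambda>n. n <# (N \<inter> ((g <# H) #> inv g))))"
proof -
  let ?p = "\<lambda>x. x <# H" and ?q = "\<lambda>n. n <# (N \<inter> ((g <# H) #> inv g))"
  have eq: "?p (a \<otimes> g) = ?p (b \<otimes> g) \<longleftrightarrow> ?q a = ?q b" if "a \<in> N" "b \<in> N" for a b
    using that assms by (intro lcos_translate_eq_iff)
  have Ng: "N #> g = (\<lambda>n. n \<otimes> g) ` N"
    by (auto simp: r_coset_def)
  obtain f where bij: "bij_betw f ((\<lambda>n. ?p (n \<otimes> g)) ` N) (?q ` N)"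
    and f: "\<And>n. n \<in> N \<Longrightarrow> f (?p (n \<otimes> g)) = ?q n"
    using ex_bij_betw_images[of N "\<lambda>n. ?p (n \<otimes> g)" ?q] eq by blast
  have "bij_betw f (?p ` (N #> g)) (?q ` N)"
    using bij by (simp add: Ng image_image)
  moreover have "quotient_dist N d ?q (f C) (f C') = quotient_dist (N #> g) d ?p C C'"
    if C: "C \<in> ?p ` (N #> g)" "C' \<in> ?p ` (N #> g)" for C C'
  proof -
    obtain a b where ab: "a \<in> N" "b \<in> N" "C = ?p (a \<otimes> g)" "C' = ?p (b \<otimes> g)"
      using C by (auto simp: Ng)
    have d: "d (x \<otimes> g) (y \<otimes> g) = d x y" if "x \<in> N" "y \<in> N" for x y
      using that g inv subgroup.mem_carrier[OF N] by (auto simp: right_invariant_def)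
    \<comment> \<open>Outside \<open>N\<close> both sides are false. Having the equivalence for all
      \<open>x\<close> and \<open>y\<close> allows rewriting under the set comprehension
      below.\<close>
    have iff: "r = d (x \<otimes> g) (y \<otimes> g) \<and> x \<in> N \<and> y \<in> N \<and> ?p (x \<otimes> g) = C \<and> ?p (y \<otimes> g) = C' \<longleftrightarrow>
        r = d x y \<and> x \<in> N \<and> y \<in> N \<and> ?q x = ?q a \<and> ?q y = ?q b" for r x y
      by (cases "x \<in> N"; cases "y \<in> N") (simp_all add: ab d eq)
    have "{d x y |x y. x \<in> N #> g \<and> y \<in> N #> g \<and> ?p x = C \<and> ?p y = C'} =
      {d (x \<otimes> g) (y \<otimes> g) |x y. x \<in> N \<and> y \<in> N \<and> ?p (x \<otimes> g) = C \<and> ?p (y \<otimes> g) = C'}"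
      by (auto simp: Ng)
    also have "\<dots> = {d x y |x y. x \<in> N \<and> y \<in> N \<and> ?q x = ?q a \<and> ?q y = ?q b}"
      by (simp only: iff)
    finally show ?thesis
      using ab by (simp add: quotient_dist_def f)
  qed
  ultimately show ?thesis
    unfolding isometric_def by blast
qed

end

section \<open>The map \<rho> and its fibres\<close>

locale group_epi_subgroup = group_hom G K \<pi> + sub: subgroup H G
  for G (structure) and K (structure) and \<pi> and H +
  assumes surj: "\<pi> ` carrier G = carrier K"
begin

abbreviation N where "N \<equiv> kernel G K \<pi>"
abbreviation pG where "pG x \<equiv> x <#\<^bsub>G\<^esub> H"
abbreviation pK where "pK k \<equiv> k <#\<^bsub>K\<^esub> (\<pi> ` H)"

lemma normal_N: "normal N G"
  by (rule normal_kernel)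

lemma mem_N: "n \<in> N \<longleftrightarrow> n \<in> carrier G \<and> \<pi> n = \<one>\<^bsub>K\<^esub>"
  by (auto simp: kernel_def)

lemma subgroup_N: "subgroup N G"
  by (rule subgroup_kernel)

lemma image_H: "subgroup (\<pi> ` H) K"
  using subgroup_img_is_subgroup sub.subgroup_axioms by blast

text \<open>Normality in computational form: an element of the kernel moves from the left of
  \<open>x\<close> to the right at the cost of a conjugation. On the right, it can be absorbed by
  right-invariance.\<close>

lemma N_right: "n \<otimes>\<^bsub>G\<^esub> x = x \<otimes>\<^bsub>G\<^esub> (inv\<^bsub>G\<^esub> x \<otimes>\<^bsub>G\<^esub> n \<otimes>\<^bsub>G\<^esub> x)" "inv\<^bsub>G\<^esub> x \<otimes>\<^bsub>G\<^esub> n \<otimes>\<^bsub>G\<^esub> x \<in> N"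
  if "n \<in> N" "x \<in> carrier G"
proof -
  have "n \<in> carrier G"
    using that by (simp add: mem_N)
  then show "n \<otimes>\<^bsub>G\<^esub> x = x \<otimes>\<^bsub>G\<^esub> (inv\<^bsub>G\<^esub> x \<otimes>\<^bsub>G\<^esub> n \<otimes>\<^bsub>G\<^esub> x)"
    using that by (simp add: G.m_assoc[symmetric])
  show "inv\<^bsub>G\<^esub> x \<otimes>\<^bsub>G\<^esub> n \<otimes>\<^bsub>G\<^esub> x \<in> N"
    using that by (simp add: mem_N)
qed

text \<open>Makes the direct image under \<open>\<pi>\<close> a candidate for \<rho>. It is defined
  on cosets as sets, so no choice of representatives arises.\<close>

lemma image_lcos:
  assumes "x \<in> carrier G" "A \<subseteq> carrier G"
  shows "\<pi> ` (x <#\<^bsub>G\<^esub> A) = \<pi> x <#\<^bsub>K\<^esub> (\<pi> ` A)"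
proof -
  have "\<pi> ` (x <#\<^bsub>G\<^esub> A) = (\<lambda>a. \<pi> (x \<otimes>\<^bsub>G\<^esub> a)) ` A"
    by (auto simp: l_coset_def)
  also have "\<dots> = (\<lambda>a. \<pi> x \<otimes>\<^bsub>K\<^esub> \<pi> a) ` A"
    using assms by (intro image_cong hom_mult) auto
  finally show ?thesis
    by (auto simp: l_coset_def)
qed

text \<open>If \<open>\<pi> y\<close> is the product of \<open>\<pi> x\<close> and
  \<open>\<pi> h\<close>, then n = y(xh)^-1 is in the kernel and y = nxh lies in the coset of nx.
  Thus points of G/H over the same point of K/\<pi>(H) form one \<open>N\<close>-orbit.\<close>

lemma image_lcos_eq_iff:
  assumes "x \<in> carrier G" "y \<in> carrier G"
  shows "pK (\<pi> x) = pK (\<pi> y) \<longleftrightarrow> (\<exists>n\<in>N. pG y = pG (n \<otimes>\<^bsub>G\<^esub> x))"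
proof
  assume "pK (\<pi> x) = pK (\<pi> y)"
  then obtain h where h: "h \<in> H" "\<pi> y = \<pi> x \<otimes>\<^bsub>K\<^esub> \<pi> h"
    using assms image_H by (auto simp: H.lcos_eq_iff_ex)
  let ?n = "y \<otimes>\<^bsub>G\<^esub> inv\<^bsub>G\<^esub> (x \<otimes>\<^bsub>G\<^esub> h)"
  have "?n \<in> N"
    using assms h sub.mem_carrier by (simp add: mem_N)
  moreover have "pG y = pG (?n \<otimes>\<^bsub>G\<^esub> x)"
  proof -
    have "y = ?n \<otimes>\<^bsub>G\<^esub> x \<otimes>\<^bsub>G\<^esub> h"
      using assms h sub.mem_carrier by (simp add: G.m_assoc)
    moreover have "?n \<otimes>\<^bsub>G\<^esub> x \<in> carrier G"
      using assms h sub.mem_carrier by simp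
    ultimately show ?thesis
      using assms(2) h(1) G.lcos_eq_iff_ex[OF sub.subgroup_axioms, of "?n \<otimes>\<^bsub>G\<^esub> x" y] by metis
  qed
  ultimately show "\<exists>n\<in>N. pG y = pG (n \<otimes>\<^bsub>G\<^esub> x)"
    by blast
next
  assume "\<exists>n\<in>N. pG y = pG (n \<otimes>\<^bsub>G\<^esub> x)"
  then obtain n where n: "n \<in> N" "pG y = pG (n \<otimes>\<^bsub>G\<^esub> x)"
    by blast
  then have "\<pi> ` pG y = \<pi> ` pG (n \<otimes>\<^bsub>G\<^esub> x)"
    by simp
  then show "pK (\<pi> x) = pK (\<pi> y)"
    using n(1) assms sub.subset by (simp add: image_lcos mem_N)
qed

lemma image_mem_lcosets:
  assumes "C \<in> lcosets\<^bsub>G\<^esub> H"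
  shows "\<pi> ` C \<in> lcosets\<^bsub>K\<^esub> (\<pi> ` H)"
proof -
  obtain x where "x \<in> carrier G" "C = pG x"
    using assms by (auto simp: lcosets_eq_image)
  then show ?thesis
    using sub.subset by (simp add: image_lcos lcosets_eq_image)
qed

lemma ex1_equivariant_factor: "\<exists>!\<rho>. equivariant_factor G K \<pi> H \<rho>"
proof (rule ex1I)
  let ?\<rho> = "\<lambda>C\<in>lcosets\<^bsub>G\<^esub> H. \<pi> ` C"
  have "?\<rho> (x <#\<^bsub>G\<^esub> C) = \<pi> x <#\<^bsub>K\<^esub> ?\<rho> C" if x: "x \<in> carrier G" and C: "C \<in> lcosets\<^bsub>G\<^esub> H" for x C
  proof -
    have "x <#\<^bsub>G\<^esub> C \<in> lcosets\<^bsub>G\<^esub> H"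
      using x C sub.subset by (auto simp: lcosets_eq_image G.lcos_m_assoc)
    then show ?thesis
      using x C by (simp add: image_lcos sub.lcosets_carrier)
  qed
  then show "equivariant_factor G K \<pi> H ?\<rho>"
    using sub.subset by (auto simp: equivariant_factor_def image_mem_lcosets image_lcos lcosets_eq_image)
  show "\<rho> = ?\<rho>" if "equivariant_factor G K \<pi> H \<rho>" for \<rho>
  proof (rule ext)
    fix C
    show "\<rho> C = ?\<rho> C"
    proof (cases "C \<in> lcosets\<^bsub>G\<^esub> H")
      case True
      then obtain x where "x \<in> carrier G" "C = pG x"
        by (auto simp: lcosets_eq_image)
      with True show ?thesis
        using that sub.subset by (simp add: equivariant_factor_def image_lcos)
    next
      case False
      \<comment> \<open>Off G/H, extensionality forces the value \<open>undefined\<close> on both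
        sides.\<close>
      have "\<rho> \<in> lcosets\<^bsub>G\<^esub> H \<rightarrow>\<^sub>E lcosets\<^bsub>K\<^esub> (\<pi> ` H)"
        using that unfolding equivariant_factor_def by blast
      from PiE_arb[OF this False] False show ?thesis
        by simp
    qed
  qed
qed

text \<open>The fibre is the \<open>N\<close>-orbit of \<open>pG g\<close>, that is, the image of
  Ng; normality of the kernel replaces Ng by gN.\<close>

lemma fibre_eq:
  assumes \<rho>: "equivariant_factor G K \<pi> H \<rho>" and g: "g \<in> carrier G"
  shows "{C \<in> lcosets\<^bsub>G\<^esub> H. \<rho> C = pK (\<pi> g)} = pG ` (g <#\<^bsub>G\<^esub> N)"
proof -
  have "{C \<in> lcosets\<^bsub>G\<^esub> H. \<rho> C = pK (\<pi> g)} = pG ` {x \<in> carrier G. pK (\<pi> g) = pK (\<pi> x)}"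
    using \<rho> by (auto simp: equivariant_factor_def lcosets_eq_image)
  also have "\<dots> = pG ` (N #>\<^bsub>G\<^esub> g)"
  proof (intro subset_antisym subsetI)
    fix C assume "C \<in> pG ` {x \<in> carrier G. pK (\<pi> g) = pK (\<pi> x)}"
    then obtain x where "x \<in> carrier G" "C = pG x" "pK (\<pi> g) = pK (\<pi> x)"
      by blast
    then obtain n where "n \<in> N" "C = pG (n \<otimes>\<^bsub>G\<^esub> g)"
      using image_lcos_eq_iff[OF g] by metis
    then show "C \<in> pG ` (N #>\<^bsub>G\<^esub> g)"
      unfolding r_coset_def by blast
  next
    fix C assume "C \<in> pG ` (N #>\<^bsub>G\<^esub> g)"
    then obtain n where n: "n \<in> N" "C = pG (n \<otimes>\<^bsub>G\<^esub> g)"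
      by (auto simp: r_coset_def)
    have "n \<otimes>\<^bsub>G\<^esub> g \<in> carrier G" "\<pi> (n \<otimes>\<^bsub>G\<^esub> g) = \<pi> g"
      using n g by (simp_all add: mem_N)
    then show "C \<in> pG ` {x \<in> carrier G. pK (\<pi> g) = pK (\<pi> x)}"
      unfolding n(2) by (intro imageI) simp
  qed
  also have "N #>\<^bsub>G\<^esub> g = g <#\<^bsub>G\<^esub> N"
    using normal_N g by (simp add: normal.coset_eq)
  finally show ?thesis .
qed

text \<open>Elements of \<open>N\<close> act trivially on K/\<pi>(H), so equivariance gives one
  inclusion. Applying it to the inverse of \<open>n\<close> gives equality.\<close>

lemma fibre_invariant:
  assumes \<rho>: "equivariant_factor G K \<pi> H \<rho>" and "k \<in> carrier K" and n: "n \<in> N"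
  shows "(\<lambda>C. n <#\<^bsub>G\<^esub> C) ` {C \<in> lcosets\<^bsub>G\<^esub> H. \<rho> C = pK k} = {C \<in> lcosets\<^bsub>G\<^esub> H. \<rho> C = pK k}"
proof -
  let ?F = "{C \<in> lcosets\<^bsub>G\<^esub> H. \<rho> C = pK k}"
  have sub': "m <#\<^bsub>G\<^esub> C \<in> ?F" if m: "m \<in> N" and C: "C \<in> ?F" for m C
  proof -
    have "m <#\<^bsub>G\<^esub> C \<in> lcosets\<^bsub>G\<^esub> H"
      using m C sub.subset by (auto simp: lcosets_eq_image G.lcos_m_assoc mem_N)
    moreover have "\<rho> (m <#\<^bsub>G\<^esub> C) = \<one>\<^bsub>K\<^esub> <#\<^bsub>K\<^esub> pK k"
      using m C \<rho> by (auto simp: equivariant_factor_def mem_N)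
    moreover have "\<one>\<^bsub>K\<^esub> <#\<^bsub>K\<^esub> pK k = pK k"
      using assms image_H by (simp add: H.lcos_m_assoc subgroup.subset)
    ultimately show ?thesis
      by simp
  qed
  have "C \<in> (\<lambda>C. n <#\<^bsub>G\<^esub> C) ` ?F" if C: "C \<in> ?F" for C
  proof
    show "inv\<^bsub>G\<^esub> n <#\<^bsub>G\<^esub> C \<in> ?F"
      using C n subgroup_N by (intro sub') (simp_all add: subgroup.m_inv_closed)
    have "C \<subseteq> carrier G"
      using C sub.lcosets_carrier by auto
    then show "C = n <#\<^bsub>G\<^esub> (inv\<^bsub>G\<^esub> n <#\<^bsub>G\<^esub> C)"
      using n by (simp add: G.lcos_m_assoc mem_N G.lcos_mult_one)
  qed
  with sub' n show ?thesis
    by blast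
qed

section \<open>Finiteness of the index\<close>

lemma finite_lcosets_N_iff: "finite (lcosets\<^bsub>G\<lparr>carrier := N\<rparr>\<^esub> (N \<inter> H)) \<longleftrightarrow> finite (pG ` N)"
proof -
  let ?q = "\<lambda>n. n <#\<^bsub>G\<^esub> (N \<inter> H)"
  have L: "subgroup (N \<inter> H) G"
    using subgroup_N sub.subgroup_axioms by (rule G.subgroups_Inter_pair)
  \<comment> \<open>For \<open>a\<close> and \<open>b\<close> in \<open>N\<close> the element a^-1 b
    is already in \<open>N\<close>, so lying in \<open>H\<close> and lying in
    \<open>N \<inter> H\<close> amount to the same.\<close>
  have eq: "pG a = pG b \<longleftrightarrow> ?q a = ?q b" if "a \<in> N" "b \<in> N" for a b
    using that L sub.subgroup_axioms subgroup_N subgroup.m_inv_closed[OF subgroup_N]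
      subgroup.m_closed[OF subgroup_N]
    by (simp add: G.lcos_eq_iff mem_N)
  obtain f where "bij_betw f (pG ` N) (?q ` N)"
    using ex_bij_betw_images[of N pG ?q, OF eq] by metis
  then have "finite (pG ` N) \<longleftrightarrow> finite (?q ` N)"
    by (rule bij_betw_finite)
  then show ?thesis
    by (simp add: lcosets_eq_image)
qed

text \<open>G/H maps onto K/\<pi>(H) and contains \<open>pG\<close> N\<open>, a copy of N/(N
  \<inter> H). Conversely, G/H is the union of the fibres of \<rho>, all of which are translates
  of\<close>pG \<open>N\<close>.\<close>

lemma finite_lcosets_iff:
  "finite (lcosets\<^bsub>G\<^esub> H) \<longleftrightarrow>
    finite (lcosets\<^bsub>K\<^esub> (\<pi> ` H)) \<and> finite (lcosets\<^bsub>G\<lparr>carrier := N\<rparr>\<^esub> (N \<inter> H))"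
proof -
  obtain \<rho> where \<rho>: "equivariant_factor G K \<pi> H \<rho>"
    using ex1_equivariant_factor by blast
  have im: "\<rho> ` (lcosets\<^bsub>G\<^esub> H) = lcosets\<^bsub>K\<^esub> (\<pi> ` H)"
  proof -
    have "\<rho> ` (lcosets\<^bsub>G\<^esub> H) = pK ` \<pi> ` carrier G"
      using \<rho> by (auto simp: equivariant_factor_def lcosets_eq_image image_image)
    then show ?thesis
      by (simp add: surj lcosets_eq_image)
  qed
  have "finite (lcosets\<^bsub>G\<^esub> H)" if K: "finite (lcosets\<^bsub>K\<^esub> (\<pi> ` H))" and N: "finite (pG ` N)"
  proof -
    have "finite (\<rho> -` {D} \<inter> lcosets\<^bsub>G\<^esub> H)" if "D \<in> lcosets\<^bsub>K\<^esub> (\<pi> ` H)" for D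
    proof -
      have "D \<in> pK ` \<pi> ` carrier G"
        using that by (simp add: surj lcosets_eq_image)
      then obtain g where g: "g \<in> carrier G" "D = pK (\<pi> g)"
        by blast
      have "\<rho> -` {D} \<inter> lcosets\<^bsub>G\<^esub> H = {C \<in> lcosets\<^bsub>G\<^esub> H. \<rho> C = pK (\<pi> g)}"
        using g by auto
      also have "\<dots> = pG ` (g <#\<^bsub>G\<^esub> N)"
        by (rule fibre_eq[OF \<rho> g(1)])
      also have "\<dots> = pG ` (\<lambda>n. g \<otimes>\<^bsub>G\<^esub> n) ` N"
        by (rule arg_cong[where f = "image pG"]) (auto simp: l_coset_def)
      also have "\<dots> = (\<lambda>C. g <#\<^bsub>G\<^esub> C) ` pG ` N"
        unfolding image_image using g sub.subset
        by (intro image_cong) (simp_all add: G.lcos_m_assoc mem_N)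
      finally show ?thesis
        using N by simp
    qed
    then have "finite (\<rho> -` (lcosets\<^bsub>K\<^esub> (\<pi> ` H)) \<inter> lcosets\<^bsub>G\<^esub> H)"
      by (rule finite_finite_vimage_IntI[OF K])
    then show ?thesis
      by (rule finite_subset[rotated]) (use im in blast)
  qed
  moreover have "finite (lcosets\<^bsub>K\<^esub> (\<pi> ` H))" if "finite (lcosets\<^bsub>G\<^esub> H)"
    using that im by (metis finite_imageI)
  moreover have "finite (pG ` N)" if "finite (lcosets\<^bsub>G\<^esub> H)"
    using that by (rule finite_subset[rotated]) (auto simp: lcosets_eq_image mem_N)
  ultimately show ?thesis
    unfolding finite_lcosets_N_iff by metis
qed

section \<open>Quotient metrics and preimages of balls\<close>

context
  fixes d :: "'a \<Rightarrow> 'a \<Rightarrow> real" and \<rho>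
  assumes proper: "proper_metric (carrier G) d" and inv: "right_invariant G d"
    and \<rho>: "equivariant_factor G K \<pi> H \<rho>"
begin

interpretation Metric_space "carrier G" d
  using proper by (simp add: proper_metric_def)

abbreviation dGH where "dGH \<equiv> quotient_dist (carrier G) d pG"
abbreviation dKH where
  "dKH \<equiv> quotient_dist (carrier K) (quotient_dist (carrier G) d \<pi>) pK"

lemma dKH_eq:
  assumes "C \<in> lcosets\<^bsub>K\<^esub> (\<pi> ` H)" "C' \<in> lcosets\<^bsub>K\<^esub> (\<pi> ` H)"
  shows "dKH C C' = quotient_dist (carrier G) d (\<lambda>x. pK (\<pi> x)) C C'"
  using quotient_dist_comp[of "carrier G" d C pK \<pi> C'] assms
  by (simp add: surj lcosets_eq_image)

text \<open>Both distances are two-stage infima that collapse to the quotient distance of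
  \<open>d\<close> along one map from G to K/\<pi>(H), because \<open>\<rho> (pG x)\<close> and
  \<open>pK (\<pi> x)\<close> agree on G.\<close>

lemma dKH_eq_quotient_dist:
  assumes "C \<in> lcosets\<^bsub>K\<^esub> (\<pi> ` H)" "C' \<in> lcosets\<^bsub>K\<^esub> (\<pi> ` H)"
  shows "dKH C C' = quotient_dist (lcosets\<^bsub>G\<^esub> H) dGH \<rho> C C'"
proof -
  have eq: "pK (\<pi> x) = \<rho> (pG x)" if "x \<in> carrier G" for x
    using \<rho> that by (simp add: equivariant_factor_def)
  have "\<rho> ` pG ` carrier G = lcosets\<^bsub>K\<^esub> (\<pi> ` H)"
    unfolding lcosets_eq_image surj[symmetric] by (force simp: eq)
  then have "quotient_dist (lcosets\<^bsub>G\<^esub> H) dGH \<rho> C C' = quotient_dist (carrier G) d (\<lambda>x. \<rho> (pG x)) C C'"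
    using quotient_dist_comp[of "carrier G" d C \<rho> pG C'] assms by (simp add: lcosets_eq_image)
  also have "\<dots> = quotient_dist (carrier G) d (\<lambda>x. pK (\<pi> x)) C C'"
    by (subst quotient_dist_cong[OF eq]) simp_all
  finally show ?thesis
    using assms by (simp add: dKH_eq)
qed

text \<open>After pulling back to G, a pair realising the distance between two fibres is
  right-translated until its first point lies in \<open>N\<close>. Conversely, n in \<open>N\<close>
  and x with \<open>d n x\<close> at most \<open>R\<close> give the pair (ng, xg), which bounds the
  distance.\<close>

lemma preimage_ball:
  assumes g: "g \<in> carrier G"
  shows "{C \<in> lcosets\<^bsub>G\<^esub> H. \<rho> C \<in> closed_nbhd (lcosets\<^bsub>K\<^esub> (\<pi> ` H)) dKH {pK (\<pi> g)} R} =
    pG ` (closed_nbhd (carrier G) d N R #>\<^bsub>G\<^esub> g)"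
proof -
  let ?D = "quotient_dist (carrier G) d (\<lambda>x. pK (\<pi> x))"
  let ?P = "{x \<in> carrier G. \<exists>n\<in>N. d n x \<le> R}"
  have nbhd: "closed_nbhd (carrier G) d N R = ?P"
    using subgroup_N proper inv subgroup.one_closed
    by (intro G.closed_nbhd_eq subgroup.subset) auto
  have d_right: "d (x \<otimes>\<^bsub>G\<^esub> z) (y \<otimes>\<^bsub>G\<^esub> z) = d x y"
    if "x \<in> carrier G" "y \<in> carrier G" "z \<in> carrier G" for x y z
    using inv that by (simp add: right_invariant_def)
  have mem: "pK (\<pi> x) \<in> lcosets\<^bsub>K\<^esub> (\<pi> ` H)" if "x \<in> carrier G" for x
    using that by (auto simp: lcosets_eq_image)
  have "{C \<in> lcosets\<^bsub>G\<^esub> H. \<rho> C \<in> closed_nbhd (lcosets\<^bsub>K\<^esub> (\<pi> ` H)) dKH {pK (\<pi> g)} R} =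
      pG ` {x \<in> carrier G. ?D (pK (\<pi> g)) (pK (\<pi> x)) \<le> R}"
    using \<rho> g mem by (auto simp: lcosets_eq_image[of G] equivariant_factor_def closed_nbhd_def dKH_eq)
  also have "\<dots> = pG ` (?P #>\<^bsub>G\<^esub> g)"
  proof (intro subset_antisym subsetI)
    fix C assume "C \<in> pG ` {x \<in> carrier G. ?D (pK (\<pi> g)) (pK (\<pi> x)) \<le> R}"
    then obtain y where y: "y \<in> carrier G" "C = pG y" "?D (pK (\<pi> g)) (pK (\<pi> y)) \<le> R"
      by auto
    obtain u v where uv: "u \<in> carrier G" "v \<in> carrier G" "pK (\<pi> u) = pK (\<pi> g)"
        "pK (\<pi> v) = pK (\<pi> y)" "?D (pK (\<pi> g)) (pK (\<pi> y)) = d u v"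
      using G.quotient_dist_attained[OF proper inv g y(1), of "\<lambda>x. pK (\<pi> x)"] by blast
    obtain n where n: "n \<in> N" "pG u = pG (n \<otimes>\<^bsub>G\<^esub> g)"
      using image_lcos_eq_iff[of g u] uv g by auto
    obtain m where m: "m \<in> N" "pG y = pG (m \<otimes>\<^bsub>G\<^esub> v)"
      using image_lcos_eq_iff[of v y] uv y by auto
    have nm: "n \<in> carrier G" "m \<in> carrier G"
      using n m by (auto simp: mem_N)
    obtain h where h: "h \<in> H" "n \<otimes>\<^bsub>G\<^esub> g = u \<otimes>\<^bsub>G\<^esub> h"
      using n nm g uv G.lcos_eq_iff_ex[OF sub.subgroup_axioms, of u "n \<otimes>\<^bsub>G\<^esub> g"] by auto
    \<comment> \<open>Right translation by hg^-1 takes the pair (u, v) to (n, w), which preserves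
      its distance and puts the first point in \<open>N\<close>.\<close>
    define w where "w = v \<otimes>\<^bsub>G\<^esub> h \<otimes>\<^bsub>G\<^esub> inv\<^bsub>G\<^esub> g"
    have hw: "h \<in> carrier G" "w \<in> carrier G"
      using h uv g by (auto simp: w_def)
    have "n = u \<otimes>\<^bsub>G\<^esub> h \<otimes>\<^bsub>G\<^esub> inv\<^bsub>G\<^esub> g"
      using h hw uv nm g by (metis G.inv_solve_right G.m_closed)
    then have "d n w = d u v"
      using uv hw g by (simp add: w_def d_right)
    \<comment> \<open>The point representing \<open>C\<close> is mwg rather than wg. Writing mw =
      wm' lets right-invariance compare mw with nm', which is again in \<open>N\<close>.\<close>
    define m' where "m' = inv\<^bsub>G\<^esub> w \<otimes>\<^bsub>G\<^esub> m \<otimes>\<^bsub>G\<^esub> w"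
    have m': "m' \<in> N" "m \<otimes>\<^bsub>G\<^esub> w = w \<otimes>\<^bsub>G\<^esub> m'"
      using N_right[of m w] m hw by (auto simp: m'_def)
    have "d (n \<otimes>\<^bsub>G\<^esub> m') (m \<otimes>\<^bsub>G\<^esub> w) = d n w"
      unfolding m'(2) using m' nm hw by (intro d_right) (auto simp: mem_N)
    moreover have "n \<otimes>\<^bsub>G\<^esub> m' \<in> N"
      using n m' subgroup_N by (simp add: subgroup.m_closed)
    ultimately have "m \<otimes>\<^bsub>G\<^esub> w \<in> ?P"
      using nm hw uv y \<open>d n w = d u v\<close> by force
    moreover have "C = pG (m \<otimes>\<^bsub>G\<^esub> w \<otimes>\<^bsub>G\<^esub> g)"
    proof -
      have "m \<otimes>\<^bsub>G\<^esub> w \<otimes>\<^bsub>G\<^esub> g = m \<otimes>\<^bsub>G\<^esub> v \<otimes>\<^bsub>G\<^esub> h"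
        using nm hw uv g by (simp add: w_def G.m_assoc)
      then have "pG (m \<otimes>\<^bsub>G\<^esub> v) = pG (m \<otimes>\<^bsub>G\<^esub> w \<otimes>\<^bsub>G\<^esub> g)"
        using nm hw uv g h G.lcos_eq_iff_ex[OF sub.subgroup_axioms] by auto
      then show ?thesis
        using m y by simp
    qed
    ultimately show "C \<in> pG ` (?P #>\<^bsub>G\<^esub> g)"
      unfolding r_coset_def by blast
  next
    fix C assume "C \<in> pG ` (?P #>\<^bsub>G\<^esub> g)"
    then obtain x n where x: "x \<in> carrier G" "n \<in> N" "d n x \<le> R" "C = pG (x \<otimes>\<^bsub>G\<^esub> g)"
      by (auto simp: r_coset_def)
    have n: "n \<in> carrier G" "\<pi> (n \<otimes>\<^bsub>G\<^esub> g) = \<pi> g"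
      using x g by (auto simp: mem_N)
    have "?D (pK (\<pi> (n \<otimes>\<^bsub>G\<^esub> g))) (pK (\<pi> (x \<otimes>\<^bsub>G\<^esub> g))) \<le> d (n \<otimes>\<^bsub>G\<^esub> g) (x \<otimes>\<^bsub>G\<^esub> g)"
      using n x g by (intro quotient_dist_lower[where q = "\<lambda>x. pK (\<pi> x)"]) simp_all
    also have "\<dots> \<le> R"
      using n x g by (simp add: d_right)
    finally show "C \<in> pG ` {x \<in> carrier G. ?D (pK (\<pi> g)) (pK (\<pi> x)) \<le> R}"
      unfolding n(2) x(4) using x g by blast
  qed
  finally show ?thesis
    by (simp add: nbhd)
qed

text \<open>If n in \<open>N\<close> is within \<open>R\<close> of x, then ng is within
  \<open>R\<close> of xg by right-invariance, and \<open>pG\<close> does not increase distances.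
  Since \<open>R\<close> is positive, \<open>N\<close> lies in its own neighbourhood, so the net is
  contained in the set.\<close>

lemma net:
  assumes g: "g \<in> carrier G" and R: "R > 0"
  shows "is_net (pG ` (closed_nbhd (carrier G) d N R #>\<^bsub>G\<^esub> g)) dGH R (pG ` (N #>\<^bsub>G\<^esub> g))"
proof -
  have nbhd: "closed_nbhd (carrier G) d N R = {x \<in> carrier G. \<exists>n\<in>N. d n x \<le> R}"
    using subgroup_N proper inv subgroup.one_closed
    by (intro G.closed_nbhd_eq subgroup.subset) auto
  have "N \<subseteq> closed_nbhd (carrier G) d N R"
    unfolding nbhd using R by (force simp: mem_N)
  moreover have "\<exists>n\<in>N. dGH (pG (x \<otimes>\<^bsub>G\<^esub> g)) (pG (n \<otimes>\<^bsub>G\<^esub> g)) \<le> R"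
    if "x \<in> closed_nbhd (carrier G) d N R" for x
  proof -
    obtain n where n: "x \<in> carrier G" "n \<in> N" "n \<in> carrier G" "d n x \<le> R"
      using \<open>x \<in> _\<close> by (auto simp: nbhd mem_N)
    have "dGH (pG (x \<otimes>\<^bsub>G\<^esub> g)) (pG (n \<otimes>\<^bsub>G\<^esub> g)) \<le> d (x \<otimes>\<^bsub>G\<^esub> g) (n \<otimes>\<^bsub>G\<^esub> g)"
      using n g by (intro quotient_dist_lower) auto
    also have "\<dots> \<le> R"
      using n g inv by (simp add: right_invariant_def commute)
    finally show ?thesis
      using n by blast
  qed
  ultimately show ?thesis
    by (fastforce simp: is_net_def r_coset_def)
qed

end

end

theorem lemma4p1:
  fixes G :: "('a, 'm) monoid_scheme" and K :: "('b, 'n) monoid_scheme"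
    and N H :: "'a set" and \<pi> :: "'a \<Rightarrow> 'b"
  assumes exact: "short_exact (G\<lparr>carrier := N\<rparr>) G K (\<lambda>x. x) \<pi>"
    and H: "subgroup H G"
  shows
    "(\<exists>!\<rho>. equivariant_factor G K \<pi> H \<rho>) \<and>
     (\<forall>\<rho>. equivariant_factor G K \<pi> H \<rho> \<longrightarrow>
       (\<forall>k\<in>carrier K.
         let F = {C \<in> lcosets\<^bsub>G\<^esub> H. \<rho> C = k <#\<^bsub>K\<^esub> (\<pi> ` H)} in
         (\<forall>g\<in>carrier G. \<pi> g = k \<longrightarrow> F = (\<lambda>x. x <#\<^bsub>G\<^esub> H) ` (g <#\<^bsub>G\<^esub> N)) \<and>
         (\<forall>n\<in>N. (\<lambda>C. n <#\<^bsub>G\<^esub> C) ` F = F))) \<and>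
     (finite (lcosets\<^bsub>G\<^esub> H) \<longleftrightarrow>
       finite (lcosets\<^bsub>K\<^esub> (\<pi> ` H)) \<and> finite (lcosets\<^bsub>G\<lparr>carrier := N\<rparr>\<^esub> (N \<inter> H))) \<and>
     (\<forall>d \<rho>. proper_metric (carrier G) d \<and> right_invariant G d \<and> equivariant_factor G K \<pi> H \<rho> \<longrightarrow>
       (let p\<^sub>G = (\<lambda>g. g <#\<^bsub>G\<^esub> H);
            p\<^sub>K = (\<lambda>k. k <#\<^bsub>K\<^esub> (\<pi> ` H));
            d\<^sub>G\<^sub>H = quotient_dist (carrier G) d p\<^sub>G;
            d\<^sub>K = quotient_dist (carrier G) d \<pi>;
            d\<^sub>K\<^sub>H = quotient_dist (carrier K) d\<^sub>K p\<^sub>K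
        in
        (\<forall>C\<in>lcosets\<^bsub>K\<^esub> (\<pi> ` H). \<forall>C'\<in>lcosets\<^bsub>K\<^esub> (\<pi> ` H).
           d\<^sub>K\<^sub>H C C' = quotient_dist (lcosets\<^bsub>G\<^esub> H) d\<^sub>G\<^sub>H \<rho> C C') \<and>
        (\<forall>R>0. \<forall>k\<in>carrier K. \<forall>g\<in>carrier G. \<pi> g = k \<longrightarrow>
           (let S = {C \<in> lcosets\<^bsub>G\<^esub> H. \<rho> C \<in> closed_nbhd (lcosets\<^bsub>K\<^esub> (\<pi> ` H)) d\<^sub>K\<^sub>H {p\<^sub>K k} R};
                G\<^sub>N = G\<lparr>carrier := N\<rparr>;
                L = N \<inter> (g <#\<^bsub>G\<^esub> H #>\<^bsub>G\<^esub> inv\<^bsub>G\<^esub> g)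
            in
            S = p\<^sub>G ` (closed_nbhd (carrier G) d N R #>\<^bsub>G\<^esub> g) \<and>
            is_net S d\<^sub>G\<^sub>H R (p\<^sub>G ` (N #>\<^bsub>G\<^esub> g)) \<and>
            isometric
              (p\<^sub>G ` (N #>\<^bsub>G\<^esub> g)) (quotient_dist (N #>\<^bsub>G\<^esub> g) d p\<^sub>G)
              (lcosets\<^bsub>G\<^sub>N\<^esub> L) (quotient_dist N d (\<lambda>n. n <#\<^bsub>G\<^sub>N\<^esub> L))))))"
proof -
  interpret group_epi_subgroup G K \<pi> H
    using exact H unfolding short_exact_def epi_def
    by (intro group_epi_subgroup.intro group_hom.intro group_hom_axioms.intro
        group_epi_subgroup_axioms.intro) auto
  \<comment> \<open>As \<iota> is the inclusion, exactness at G identifies \<open>N\<close> with the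
    kernel used in the locale.\<close>
  have N: "N = kernel G K \<pi>"
    using exact by (simp add: short_exact_def)
  show ?thesis
    unfolding N Let_def
  proof (intro conjI allI impI ballI, goal_cases)
    case 1
    show ?case by (rule ex1_equivariant_factor)
  next
    case (2 \<rho> k g)
    then show ?case using fibre_eq by blast
  next
    case (3 \<rho> k n)
    then show ?case by (intro fibre_invariant)
  next
    case 4
    show ?case by (rule finite_lcosets_iff)
  next
    case (5 d \<rho> C C')
    then show ?case by (intro dKH_eq_quotient_dist) auto
  next
    case (6 d \<rho> R k g)
    then have "k = \<pi> g"
      by simp
    show ?case
      unfolding \<open>k = \<pi> g\<close> using 6 by (intro preimage_ball) simp_all
  next
    case (7 d \<rho> R k g)
    then have "k = \<pi> g"
      by simp
    \<comment> \<open>The net property is known for the image of the neighbourhood of the kernel;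
      this equality transfers it to the preimage of the ball.\<close>
    have "{C \<in> lcosets\<^bsub>G\<^esub> H. \<rho> C \<in> closed_nbhd (lcosets\<^bsub>K\<^esub> (\<pi> ` H)) (dKH d) {pK (\<pi> g)} R} =
        pG ` (closed_nbhd (carrier G) d (kernel G K \<pi>) R #>\<^bsub>G\<^esub> g)"
      using 7 by (intro preimage_ball) simp_all
    then show ?case
      unfolding \<open>k = \<pi> g\<close> using 7 net[of d \<rho> g R] by simp
  next
    case (8 d \<rho> R k g)
    then show ?case
      using G.isometric_orbit_coset_space[OF _ subgroup_N H, of d g]
      \<comment> \<open>Cosets taken in the group on \<open>N\<close> coincide with those taken in
        G, as the multiplication is the same.\<close>
      unfolding lcosets_eq_image l_coset_consistent by simp
  qed
qed

end
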